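(* Let $d\geq 1$ be an integer and let $1\leq p,q \leq \infty$ be such that $\frac{1}{p}+\frac{1}{q}=\frac{\log_{2}6}{2}$. Then $$\|f*g\|_{\ell^2(\mathbb{Z}^d)}\leq \|f\|_{\ell^p(\mathbb{Z}^d)}\,\|g\|_{\ell^q(\mathbb{Z}^d)}$$ holds for all $f,g:\mathbb{Z}^d\to \mathbb{R}$ supported in $\{0,1\}^d$ if and only if both $p$ and $q$ belong to the interval $\Big[\frac{4}{3},\ \frac{1}{\frac{\log_2 3}{2}-\frac{1}{4}}\Big]$.
   Context: A function $f:\mathbb{Z}^d\to\mathbb{R}$ is supported in $\{0,1\}^d$ if $f(x)=0$ for all $x\notin\{0,1\}^d$. Convolution: $(f*g)(x)=\sum_{y\in\mathbb{Z}^d} f(y)g(x-y)$. Norms: $\|f\|_{\ell^p(\mathbb{Z}^d)}=\big(\sum_{x\in\mathbb{Z}^d}|f(x)|^p\big)^{1/p}$ for $0<p<\infty$, and $\|f\|_{\ell^\infty(\mathbb{Z}^d)}=\sup_x|f(x)|$; the convention $1/\infty=0$ is used. *)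

theory Defs
  imports "HOL-Analysis.Analysis"
begin

text \<open>
  The lattice \<open>\<int>\<^sup>d\<close> is the type \<^typ>\<open>int ^ 'n\<close> with \<open>d = CARD('n)\<close>; since \<open>'n\<close> is a nonempty finite
  type variable, a statement about \<^typ>\<open>int ^ 'n\<close> covers every \<open>d \<ge> 1\<close>.
\<close>

definition supported_in_cube :: "(int ^ 'n \<Rightarrow> real) \<Rightarrow> bool" where
  "supported_in_cube f \<longleftrightarrow> (\<forall>x. x \<notin> {x. \<forall>i. x $ i \<in> {0, 1}} \<longrightarrow> f x = 0)"

definition convolution :: "(int ^ 'n \<Rightarrow> real) \<Rightarrow> (int ^ 'n \<Rightarrow> real) \<Rightarrow> int ^ 'n \<Rightarrow> real" where
  "convolution f g x = (\<Sum>\<^sub>\<infinity>y. f y * g (x - y))"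

text \<open>
  Meant for \<open>0 < p \<le> \<infinity>\<close>. As the norm is real-valued, it is meaningful only when finite: a divergent
  \<open>\<Sum>\<^sub>\<infinity>\<close> is \<open>0\<close>, and the supremum of an unbounded set of reals is unspecified. Finitely supported
  functions, and hence their convolutions, are unaffected.
\<close>

definition lp_norm :: "ereal \<Rightarrow> (int ^ 'n \<Rightarrow> real) \<Rightarrow> real" where
  "lp_norm p f =
    (if p = \<infinity> then (SUP x. \<bar>f x\<bar>)
     else (\<Sum>\<^sub>\<infinity>x. \<bar>f x\<bar> powr real_of_ereal p) powr (1 / real_of_ereal p))"

end

theory Submission
  imports Defs "HOL-Real_Asymp.Real_Asymp"
begin

text \<open>
  Write \<open>\<alpha> = 1/p\<close> and \<open>\<beta> = 1/q\<close>. The convolution inequality in every dimension is equivalent to its case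
  \<open>d = 1\<close>, which, for functions of unit norm, reads
  \<open>(A\<^sup>\<alpha>C\<^sup>\<beta>)\<^sup>2 + (A\<^sup>\<alpha>D\<^sup>\<beta> + B\<^sup>\<alpha>C\<^sup>\<beta>)\<^sup>2 + (B\<^sup>\<alpha>D\<^sup>\<beta>)\<^sup>2 \<le> 1\<close> whenever \<open>A + B = C + D = 1\<close> (\<open>two_point\<close>). The case
  \<open>d = 1\<close> tensorises by induction on the set of active coordinates (\<open>convolution_cube_le\<close>): splitting
  \<open>f\<close> and \<open>g\<close> along one coordinate splits \<open>f * g\<close> into three layers, to which the induction hypothesis,
  the triangle inequality in \<open>\<ell>\<^sup>2\<close> and the two-point inequality apply in turn. Conversely, functions
  living on two neighbouring points give back the two-point inequality.

  On the line \<open>\<alpha> + \<beta> = log\<^sub>2 6 / 2\<close> the case \<open>A = B = C = D\<close> is an equality. Perturbing \<open>A\<close> and \<open>B\<close> to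
  \<open>(1 \<plusminus> u)/2\<close> changes the left side, times \<open>6\<close>, by \<open>2\<alpha>(4\<alpha> - 3)u\<^sup>2\<close> to leading order, so \<open>\<alpha> \<le> 3/4\<close> is
  necessary (\<open>two_point_imp_le\<close>), and likewise \<open>\<beta> \<le> 3/4\<close>. Every monomial of the inequality is log-linear in
  \<open>(\<alpha>, \<beta>)\<close>, hence the admissible pairs form a convex set (\<open>two_point_interpolate\<close>), and only the endpoint
  \<open>\<alpha> = 3/4\<close>, \<open>\<beta> = log\<^sub>2 3 / 2 - 1/4\<close> and its mirror image remain.

  At the endpoint (\<open>two_point_endpoint\<close>) put \<open>x = C\<^sup>2\<^sup>\<beta>\<close> and \<open>y = D\<^sup>2\<^sup>\<beta>\<close>. For fixed \<open>C, D\<close> the left side is a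
  quadratic form in \<open>A\<^sup>\<alpha>, B\<^sup>\<alpha>\<close> whose maximum is bounded in closed form by
  \<open>(x\<^sup>2 + xy + y\<^sup>2) / sqrt (x\<^sup>2 + y\<^sup>2)\<close> (\<open>quadratic_form_le_of_quartic_sum\<close>). This is at most
  \<open>(x\<^sup>m + y\<^sup>m)\<^sup>1\<^sup>/\<^sup>m = 1\<close> with \<open>m = 1/(2\<beta>)\<close> (\<open>quadratic_ratio_powr_le\<close>): as functions of
  \<open>((x - y)/(x + y))\<^sup>2 \<in> [0, 1]\<close>, the \<open>m\<close>-th power of the former is convex, the \<open>m\<close>-th power of the latter is
  concave for fixed \<open>x + y\<close>, and the two agree at both ends, so a common chord separates them.
\<close>

section \<open>Two elementary inequalities behind the endpoint exponent\<close>

text \<open>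
  With \<open>a = s\<^sup>3\<close> and \<open>b = t\<^sup>3\<close> this bounds \<open>(a\<^sup>2 + b\<^sup>2)(c\<^sup>2 + d\<^sup>2) + 2abcd\<close> over the unit sphere
  \<open>a\<^sup>4\<^sup>/\<^sup>3 + b\<^sup>4\<^sup>/\<^sup>3 = 1\<close>.
  In terms of \<open>S = s\<^sup>2 + t\<^sup>2\<close> and \<open>W = s\<^sup>2t\<^sup>2\<close>, where \<open>S\<^sup>2 = 1 + 2W\<close>, the left side is an explicit function of one
  variable with the critical point \<open>s t (c\<^sup>2 + d\<^sup>2) = c d S\<close>, which is \<open>X = 1\<close> below.
\<close>
lemma quadratic_form_le_of_quartic_sum:
  fixes s t c d :: real
  assumes "s \<ge> 0" "t \<ge> 0" "c \<ge> 0" "d \<ge> 0" and N: "s ^ 4 + t ^ 4 = 1" and pos: "c > 0 \<or> d > 0"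
  shows "((s ^ 3)\<^sup>2 + (t ^ 3)\<^sup>2) * (c\<^sup>2 + d\<^sup>2) + 2 * (s ^ 3 * t ^ 3) * (c * d)
      \<le> (c ^ 4 + c\<^sup>2 * d\<^sup>2 + d ^ 4) / sqrt (c ^ 4 + d ^ 4)"
proof -
  define S W C D k where "S = s\<^sup>2 + t\<^sup>2" and "W = s\<^sup>2 * t\<^sup>2" and "C = c\<^sup>2 + d\<^sup>2" and "D = c * d"
    and "k = sqrt (c ^ 4 + d ^ 4)"
  have k: "k > 0" "k\<^sup>2 = c ^ 4 + d ^ 4"
    using pos assms by (auto simp: k_def add_pos_nonneg add_nonneg_pos)
  have C: "C > 0" using pos by (auto simp: C_def add_pos_nonneg add_nonneg_pos)
  have S2: "S\<^sup>2 = 1 + 2 * W" unfolding S_def W_def N[symmetric] by algebra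
  have S: "S > 0" "W \<ge> 0" "S\<^sup>2 \<ge> 1"
  proof -
    show W: "W \<ge> 0" by (simp add: W_def)
    show "S\<^sup>2 \<ge> 1" using W S2 by simp
    then have "S \<noteq> 0" by auto
    moreover have "S \<ge> 0" by (simp add: S_def)
    ultimately show "S > 0" by simp
  qed
  have D2: "D\<^sup>2 = (C\<^sup>2 - k\<^sup>2) / 2" unfolding k C_def D_def by (simp add: field_simps power2_eq_square power4_eq_xxxx)
  have WS: "W = (S\<^sup>2 - 1) / 2" using S2 by simp
  define X where "X = S * k / C"
  have X: "X > 0" using S C k by (simp add: X_def)
  have kX: "k = X * C / S" using S C by (simp add: X_def)
  have lhs: "((s ^ 3)\<^sup>2 + (t ^ 3)\<^sup>2) * (c\<^sup>2 + d\<^sup>2) + 2 * (s ^ 3 * t ^ 3) * (c * d)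
      = S * (1 - W) * C + 2 * W * (s * t) * D" (is "?L = _")
    unfolding S_def W_def C_def D_def N[symmetric] by algebra
  \<comment> \<open>The arithmetic-geometric mean inequality, applied so that it is sharp at the critical point.\<close>
  have "2 * ((s * t * C) * (D * S)) \<le> (s * t * C)\<^sup>2 + (D * S)\<^sup>2"
    using sum_squares_bound[of "s * t * C" "D * S"] by simp
  also have "\<dots> = W * C\<^sup>2 + D\<^sup>2 * S\<^sup>2" by (simp add: W_def power_mult_distrib)
  finally have "W * (2 * ((s * t * C) * (D * S))) \<le> W * (W * C\<^sup>2 + D\<^sup>2 * S\<^sup>2)"
    using S by (intro mult_left_mono)
  then have "(S * C) * ?L \<le> S\<^sup>2 * C\<^sup>2 * (1 - W) + W * (W * C\<^sup>2 + D\<^sup>2 * S\<^sup>2)"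
    unfolding lhs by (simp add: algebra_simps power2_eq_square)
  also have "\<dots> = C\<^sup>2 * (S\<^sup>2 * (3 - S\<^sup>2) / 2 + (S\<^sup>2 - 1)\<^sup>2 / 4 + (S\<^sup>2 - 1) * (S\<^sup>2 - X\<^sup>2) / 4)"
    unfolding D2 WS X_def using C by (simp add: field_simps power2_eq_square)
  also have "\<dots> \<le> C\<^sup>2 * ((S\<^sup>2 + X\<^sup>2) / (2 * X))"
  proof (intro mult_left_mono)
    \<comment> \<open>After clearing the denominator, the difference of the two sides has the double root \<open>X = 1\<close>.\<close>
    have "0 \<le> (X - 1)\<^sup>2 * (2 * S\<^sup>2 + (S\<^sup>2 - 1) * X)"
      using X S by (intro mult_nonneg_nonneg add_nonneg_nonneg) auto
    also have "\<dots> = (2 * S\<^sup>2 + 2 * X\<^sup>2) -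
        4 * X * (S\<^sup>2 * (3 - S\<^sup>2) / 2 + (S\<^sup>2 - 1)\<^sup>2 / 4 + (S\<^sup>2 - 1) * (S\<^sup>2 - X\<^sup>2) / 4)"
      by (simp add: field_simps power2_eq_square)
    finally show "S\<^sup>2 * (3 - S\<^sup>2) / 2 + (S\<^sup>2 - 1)\<^sup>2 / 4 + (S\<^sup>2 - 1) * (S\<^sup>2 - X\<^sup>2) / 4
        \<le> (S\<^sup>2 + X\<^sup>2) / (2 * X)"
      using X by (simp add: field_simps)
  qed simp
  also have "\<dots> = (S * C) * ((C\<^sup>2 + k\<^sup>2) / (2 * k))"
    unfolding kX using X S C by (simp add: field_simps power2_eq_square)
  finally have "?L \<le> (C\<^sup>2 + k\<^sup>2) / (2 * k)"
    using S C by (subst (asm) mult_le_cancel_left_pos) auto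
  also have "\<dots> = (c ^ 4 + c\<^sup>2 * d\<^sup>2 + d ^ 4) / k"
    unfolding k C_def using k by (simp add: field_simps power2_eq_square power4_eq_xxxx)
  finally show ?thesis by (simp add: k_def)
qed

text \<open>
  The left side is the chord over \<open>[0, 1]\<close> of the right side, regarded as a function of \<open>r\<^sup>2\<close>. The binomial
  series of the right side contains only even powers of \<open>r\<close>, and for \<open>0 < m < 1\<close> all its coefficients but the
  constant one are nonpositive.
\<close>
lemma even_part_powr_ge_chord:
  fixes m r :: real
  assumes m: "0 < m" "m < 1" and r: "0 \<le> r" "r \<le> 1"
  shows "1 - r\<^sup>2 * (1 - 2 powr (m - 1)) \<le> ((1 + r) powr m + (1 - r) powr m) / 2"
proof -
  define L where "L = (\<lambda>r::real. ((1 + r) powr m + (1 - r) powr m) / 2)"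
  have ch: "(m gchoose (2 * Suc k)) \<le> 0" for k
  proof (induction k)
    case 0
    have "(m gchoose 2) = m * (m - 1) / 2"
      by (simp add: numeral_2_eq_2 gbinomial_Suc_rec field_simps gbinomial_prod_rev)
    also have "\<dots> \<le> 0" using m by (simp add: mult_nonneg_nonpos)
    finally show ?case by simp
  next
    case (Suc k)
    have rec: "(m gchoose Suc n) = (m gchoose n) * ((m - real n) / real (Suc n))" for n
      using gbinomial_mult_1[of m n] by (simp add: field_simps)
    define w where "w = ((m - real (2 * Suc k)) / real (Suc (2 * Suc k))) *
      ((m - real (Suc (2 * Suc k))) / real (Suc (Suc (2 * Suc k))))"
    have eq: "(m gchoose (2 * Suc (Suc k))) = (m gchoose (2 * Suc k)) * w"
      using rec[of "Suc (2 * Suc k)"] rec[of "2 * Suc k"] by (simp add: w_def)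
    have "w \<ge> 0"
      unfolding w_def using m by (intro mult_nonpos_nonpos divide_nonpos_pos) auto
    then show ?case unfolding eq using Suc by (intro mult_nonpos_nonneg)
  qed
  have ser: "(\<lambda>k. (m gchoose (2 * Suc k)) * x ^ (2 * Suc k)) sums (L x - 1)" if "0 < x" "x < 1" for x
  proof -
    define c where "c = (\<lambda>n. ((m gchoose n) * x ^ n + (m gchoose n) * (- x) ^ n) / 2)"
    have "c sums L x"
      unfolding L_def c_def using that gen_binomial_real[of x m] gen_binomial_real[of "-x" m]
      by (intro sums_divide sums_add) auto
    moreover have "c n = 0" if "n \<notin> range (\<lambda>k. 2 * k)" for n
    proof -
      have "odd n" using that by (metis evenE rangeI)
      then show ?thesis by (simp add: c_def)
    qed
    ultimately have "(\<lambda>k. c (2 * k)) sums L x"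
      by (subst sums_mono_reindex) (auto simp: strict_mono_def)
    then have "(\<lambda>k. (m gchoose (2 * k)) * x ^ (2 * k)) sums L x"
      by (simp add: c_def)
    then show ?thesis
      by (subst sums_Suc_iff[where f = "\<lambda>k. (m gchoose (2 * k)) * x ^ (2 * k)"]) simp
  qed
  have mono: "(1 - L x) / x\<^sup>2 \<le> (1 - L y) / y\<^sup>2" if xy: "0 < x" "x \<le> y" "y < 1" for x y
  proof -
    have *: "(\<lambda>k. - (m gchoose (2 * Suc k)) * z ^ (2 * k)) sums ((1 - L z) / z\<^sup>2)" if "0 < z" "z < 1" for z
      using sums_minus[OF sums_divide[OF ser[OF that], of "z\<^sup>2"]] that
      by (simp add: power_add power2_eq_square minus_divide_left)
    have "- (m gchoose (2 * Suc k)) * x ^ (2 * k) \<le> - (m gchoose (2 * Suc k)) * y ^ (2 * k)" for k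
      using xy ch[of k] by (intro mult_left_mono power_mono) linarith+
    from sums_le[OF this *[of x] *[of y]] show ?thesis using xy by linarith
  qed
  show ?thesis
  proof (cases "r = 0 \<or> r = 1")
    case True then show ?thesis using m by (auto simp: powr_diff)
  next
    case False
    then have r': "0 < r" "r < 1" using r by auto
    \<comment> \<open>The series is used for \<open>\<bar>x\<bar> < 1\<close> only; the value at \<open>1\<close> is reached by continuity.\<close>
    have lim: "((\<lambda>y. (1 - L y) / y\<^sup>2) \<longlongrightarrow> (1 - L 1) / 1\<^sup>2) (at_left 1)"
      unfolding L_def using m by (intro tendsto_intros tendsto_powr') (auto intro!: eventually_at_leftI[of 0])
    have "(1 - L r) / r\<^sup>2 \<le> (1 - L 1) / 1\<^sup>2"
      using mono r' by (intro tendsto_lowerbound[OF lim]) (auto intro!: eventually_at_leftI[of r])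
    then show ?thesis using r' m by (simp add: L_def field_simps powr_diff)
  qed
qed

lemma ln_le_chord:
  fixes y :: real
  assumes "0 \<le> y" "y \<le> 1"
  shows "ln (3 + y) - ln (1 + y) / 2 \<le> (1 - y) * ln 3 + y * (ln 4 - ln 2 / 2)"
proof -
  let ?f = "\<lambda>y::real. ln (3 + y) - ln (1 + y) / 2"
  have "convex_on {0..1} ?f"
  proof (rule f''_ge0_imp_convex[where f' = "\<lambda>y. inverse (3 + y) - inverse (1 + y) / 2"
        and f'' = "\<lambda>y. (inverse (1 + y))\<^sup>2 / 2 - (inverse (3 + y))\<^sup>2"])
    fix x :: real assume x: "x \<in> {0..1}"
    show "(?f has_real_derivative inverse (3 + x) - inverse (1 + x) / 2) (at x)"
      using x by (auto intro!: derivative_eq_intros simp: inverse_eq_divide[of "1 + x"] divide_simps)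
        (simp add: algebra_simps)
    show "((\<lambda>y. inverse (3 + y) - inverse (1 + y) / 2) has_real_derivative
        (inverse (1 + x))\<^sup>2 / 2 - (inverse (3 + x))\<^sup>2) (at x)"
      using x by (auto intro!: derivative_eq_intros simp: power2_eq_square)
    have "x * x \<le> 1" using x by (simp add: mult_le_one)
    then have "2 * (1 + x)\<^sup>2 \<le> (3 + x)\<^sup>2" using x by (simp add: power2_eq_square algebra_simps)
    then have "inverse ((3 + x)\<^sup>2) \<le> inverse (2 * (1 + x)\<^sup>2)"
      using x by (intro le_imp_inverse_le) auto
    then show "0 \<le> (inverse (1 + x))\<^sup>2 / 2 - (inverse (3 + x))\<^sup>2"
      unfolding power_inverse inverse_mult_distrib by simp
  qed simp
  from convex_onD[OF this, of y 0 1] assms show ?thesis by simp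
qed

text \<open>
  The hypothesis on \<open>m\<close> says \<open>(3 / sqrt 2) powr m = 2\<close>, that is, equality for \<open>x = y\<close>. There is also equality
  when \<open>x\<close> or \<open>y\<close> is \<open>0\<close>. By homogeneity, only \<open>r = (x - y)/(x + y)\<close> matters.
\<close>
lemma quadratic_ratio_powr_le:
  fixes x y m :: real
  assumes x: "x \<ge> 0" and y: "y \<ge> 0" and pos: "x > 0 \<or> y > 0" and m: "0 < m" "m < 1"
    and m_eq: "m * (ln 3 - ln 2 / 2) = ln 2"
  shows "((x\<^sup>2 + x * y + y\<^sup>2) / sqrt (x\<^sup>2 + y\<^sup>2)) powr m \<le> x powr m + y powr m"
  using x y pos
proof (induction x y rule: linorder_wlog)
  case (sym x y)
  then show ?case
    by (simp add: add.commute[of "y\<^sup>2"] add.commute[of "y powr m"] add.assoc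
        add.left_commute[of "y * x"]
        add.left_commute[of "x * y"] mult.commute[of y x] disj_commute[of "y > 0"])
next
  case (le y x)
  define h r where "h = (x + y) / 2" and "r = (x - y) / (x + y)"
  have s: "x + y > 0" using le by linarith
  have h: "h > 0" and r: "0 \<le> r" "r \<le> 1" using le s by (auto simp: h_def r_def)
  have xy: "x = h * (1 + r)" "y = h * (1 - r)"
    using s by (simp_all add: h_def r_def field_simps)
  have ratio: "(y\<^sup>2 + y * x + x\<^sup>2) / sqrt (y\<^sup>2 + x\<^sup>2) = h * ((3 + r\<^sup>2) / sqrt (2 * (1 + r\<^sup>2)))"
  proof -
    have "y\<^sup>2 + x\<^sup>2 = h\<^sup>2 * (2 * (1 + r\<^sup>2))" unfolding xy by algebra
    then have "sqrt (y\<^sup>2 + x\<^sup>2) = h * sqrt (2 * (1 + r\<^sup>2))"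
      using h by (simp add: real_sqrt_mult)
    moreover have "y\<^sup>2 + y * x + x\<^sup>2 = h * (h * (3 + r\<^sup>2))" unfolding xy by algebra
    ultimately show ?thesis using h by simp
  qed
  have le: "((3 + r\<^sup>2) / sqrt (2 * (1 + r\<^sup>2))) powr m \<le> (1 + r) powr m + (1 - r) powr m"
  proof -
    define y where "y = r\<^sup>2"
    have y: "0 \<le> y" "y \<le> 1" using r by (auto simp: y_def power_le_one)
    have "ln (sqrt (2 * (1 + y))) = (ln 2 + ln (1 + y)) / 2"
      using y by (subst ln_sqrt, simp, subst ln_mult) auto
    then have "ln ((3 + y) / sqrt (2 * (1 + y))) = (ln (3 + y) - ln (1 + y) / 2) - ln 2 / 2"
      using y by (subst ln_div) auto
    also have "\<dots> \<le> ((1 - y) * ln 3 + y * (ln 4 - ln 2 / 2)) - ln 2 / 2"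
      using ln_le_chord[OF y] by (rule diff_right_mono)
    also have "\<dots> = (1 - y) * (ln 3 - ln 2 / 2) + y * ln 2"
    proof -
      have "ln (4 :: real) = 2 * ln 2" using ln_realpow[of 2 2] by simp
      then show ?thesis by (simp add: field_simps)
    qed
    finally have "m * ln ((3 + y) / sqrt (2 * (1 + y))) \<le> m * \<dots>"
      using m by (intro mult_left_mono) auto
    also have "\<dots> = (1 - y) * (m * (ln 3 - ln 2 / 2)) + y * (m * ln 2)"
      by (simp only: distrib_left mult.left_commute[of m])
    also have "\<dots> = (1 - y) * ln 2 + y * (m * ln 2)"
      by (simp only: m_eq)
    finally have "((3 + y) / sqrt (2 * (1 + y))) powr m \<le> exp ((1 - y) * ln 2 + y * (m * ln 2))"
      using y by (simp add: powr_def)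
    \<comment> \<open>Convexity of the exponential replaces the chord of the logarithm by the chord of the power.\<close>
    also have "\<dots> \<le> (1 - y) * exp (ln 2) + y * exp (m * ln 2)"
      using convex_onD[OF exp_convex, of y "ln 2" "m * ln 2"] y by simp
    also have "\<dots> = 2 * (1 - r\<^sup>2 * (1 - 2 powr (m - 1)))"
      by (simp add: y_def powr_def exp_diff algebra_simps)
    also have "\<dots> \<le> (1 + r) powr m + (1 - r) powr m"
      using even_part_powr_ge_chord[OF m r] by simp
    finally show ?thesis by (simp add: y_def)
  qed
  have "((y\<^sup>2 + y * x + x\<^sup>2) / sqrt (y\<^sup>2 + x\<^sup>2)) powr m
      = h powr m * ((3 + r\<^sup>2) / sqrt (2 * (1 + r\<^sup>2))) powr m"
    unfolding ratio using h by (subst powr_mult) auto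
  also have "\<dots> \<le> h powr m * ((1 + r) powr m + (1 - r) powr m)"
    using le by (intro mult_left_mono) auto
  also have "\<dots> = y powr m + x powr m"
    unfolding xy using h r by (subst (1 2) powr_mult) (auto simp: distrib_left)
  finally show ?case .
qed

section \<open>The two-point inequality and the exponents for which it holds\<close>

text \<open>
  The one-dimensional inequality for the exponents \<open>p = 1/\<alpha>\<close>, \<open>q = 1/\<beta>\<close>, normalised to functions of unit
  norm: \<open>A, B\<close> are the \<open>p\<close>-th powers of the two values of \<open>f\<close>, and \<open>C, D\<close> the \<open>q\<close>-th powers of those of \<open>g\<close>.
\<close>
definition two_point :: "real \<Rightarrow> real \<Rightarrow> bool" where
  "two_point \<alpha> \<beta> \<longleftrightarrow> (\<forall>A B C D. 0 \<le> A \<longrightarrow> 0 \<le> B \<longrightarrow> 0 \<le> C \<longrightarrow> 0 \<le> D \<longrightarrow> A + B = 1 \<longrightarrow> C + D = 1 \<longrightarrow>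
     (A powr \<alpha> * C powr \<beta>)\<^sup>2 + (A powr \<alpha> * D powr \<beta> + B powr \<alpha> * C powr \<beta>)\<^sup>2
       + (B powr \<alpha> * D powr \<beta>)\<^sup>2 \<le> 1)"

lemma two_pointD:
  assumes "two_point \<alpha> \<beta>" "0 \<le> A" "0 \<le> B" "0 \<le> C" "0 \<le> D" "A + B = 1" "C + D = 1"
  shows "(A powr \<alpha> * C powr \<beta>)\<^sup>2 + (A powr \<alpha> * D powr \<beta> + B powr \<alpha> * C powr \<beta>)\<^sup>2
       + (B powr \<alpha> * D powr \<beta>)\<^sup>2 \<le> 1"
  using assms unfolding two_point_def by blast

lemma two_point_commute:
  assumes "two_point \<alpha> \<beta>" shows "two_point \<beta> \<alpha>"
  unfolding two_point_def
proof (intro allI impI)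
  fix A B C D :: real
  assume "0 \<le> A" "0 \<le> B" "0 \<le> C" "0 \<le> D" "A + B = 1" "C + D = 1"
  from two_pointD[OF assms this(3,4,1,2,6,5)]
  show "(A powr \<beta> * C powr \<alpha>)\<^sup>2 + (A powr \<beta> * D powr \<alpha> + B powr \<beta> * C powr \<alpha>)\<^sup>2
       + (B powr \<beta> * D powr \<alpha>)\<^sup>2 \<le> 1"
    by (simp add: ac_simps)
qed

text \<open>
  Interpolation between two pairs of exponents. Because all coefficients are nonnegative, Young's inequality for
  each monomial suffices.
\<close>
lemma two_point_interpolate:
  assumes T0: "two_point \<alpha>0 \<beta>0" and T1: "two_point \<alpha>1 \<beta>1" and t: "0 \<le> t" "t \<le> 1"
  shows "two_point ((1 - t) * \<alpha>0 + t * \<alpha>1) ((1 - t) * \<beta>0 + t * \<beta>1)"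
  unfolding two_point_def
proof (intro allI impI)
  fix A B C D :: real
  assume nn: "0 \<le> A" "0 \<le> B" "0 \<le> C" "0 \<le> D" and sums: "A + B = 1" "C + D = 1"
  define M where "M = (\<lambda>s x y. x powr ((1 - s) * \<alpha>0 + s * \<alpha>1) * y powr ((1 - s) * \<beta>0 + s * \<beta>1))"
  have M: "M t x y * M t u v \<le> (1 - t) * (M 0 x y * M 0 u v) + t * (M 1 x y * M 1 u v)"
    if "0 \<le> x" "0 \<le> y" "0 \<le> u" "0 \<le> v" for x y u v
  proof (cases "x = 0 \<or> y = 0 \<or> u = 0 \<or> v = 0")
    case True
    then show ?thesis by (auto simp: M_def)
  next
    case False
    with that have pos: "x > 0" "y > 0" "u > 0" "v > 0" by auto
    have split: "z powr ((1 - t) * a + t * b) = (z powr a) powr (1 - t) * (z powr b) powr t"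
      if "z > 0" for z a b :: real
      using that by (simp add: powr_powr powr_add mult.commute)
    have "M t x y * M t u v = (M 0 x y * M 0 u v) powr (1 - t) * (M 1 x y * M 1 u v) powr t"
      unfolding M_def split[OF pos(1)] split[OF pos(2)] split[OF pos(3)] split[OF pos(4)]
      using pos by (simp add: powr_mult ac_simps)
    also have "\<dots> \<le> (1 - t) * (M 0 x y * M 0 u v) + t * (M 1 x y * M 1 u v)"
      using pos t by (intro Youngs_inequality_0) (auto simp: M_def)
    finally show ?thesis .
  qed
  have *: "(M s A C)\<^sup>2 + (M s A D + M s B C)\<^sup>2 + (M s B D)\<^sup>2 =
      M s A C * M s A C + M s A D * M s A D + M s B C * M s B C + 2 * (M s A D * M s B C)
      + M s B D * M s B D" for s
    by (simp add: power2_eq_square algebra_simps)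
  have "(M t A C)\<^sup>2 + (M t A D + M t B C)\<^sup>2 + (M t B D)\<^sup>2
      \<le> (1 - t) * ((M 0 A C)\<^sup>2 + (M 0 A D + M 0 B C)\<^sup>2 + (M 0 B D)\<^sup>2)
        + t * ((M 1 A C)\<^sup>2 + (M 1 A D + M 1 B C)\<^sup>2 + (M 1 B D)\<^sup>2)"
    unfolding * using M[OF nn(1,3,1,3)] M[OF nn(1,4,1,4)] M[OF nn(2,3,2,3)] M[OF nn(1,4,2,3)] M[OF nn(2,4,2,4)]
    by (simp add: algebra_simps)
  also have "\<dots> \<le> (1 - t) * 1 + t * 1"
    using two_pointD[OF T0 nn sums] two_pointD[OF T1 nn sums] t
    by (intro add_mono mult_left_mono) (auto simp: M_def)
  finally show "(A powr ((1 - t) * \<alpha>0 + t * \<alpha>1) * C powr ((1 - t) * \<beta>0 + t * \<beta>1))\<^sup>2 +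
     (A powr ((1 - t) * \<alpha>0 + t * \<alpha>1) * D powr ((1 - t) * \<beta>0 + t * \<beta>1) +
      B powr ((1 - t) * \<alpha>0 + t * \<alpha>1) * C powr ((1 - t) * \<beta>0 + t * \<beta>1))\<^sup>2 +
     (B powr ((1 - t) * \<alpha>0 + t * \<alpha>1) * D powr ((1 - t) * \<beta>0 + t * \<beta>1))\<^sup>2 \<le> 1"
    by (simp add: M_def)
qed

lemma two_point_endpoint: "two_point (3 / 4) (log 2 3 / 2 - 1 / 4)"
  unfolding two_point_def
proof (intro allI impI)
  define \<beta> :: real where "\<beta> = log 2 3 / 2 - 1 / 4"
  define m where "m = 1 / (2 * \<beta>)"
  have "ln 2 < ln (3::real) - ln 2 / 2"
  proof -
    have "ln (8::real) < ln 9" by (subst ln_less_cancel_iff) auto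
    moreover have "ln (8 :: real) = 3 * ln 2" "ln (9 :: real) = 2 * ln 3"
      using ln_realpow[of 2 3] ln_realpow[of 3 2] by simp_all
    ultimately show ?thesis by linarith
  qed
  moreover have \<beta>_eq: "2 * \<beta> * ln 2 = ln 3 - ln 2 / 2"
    by (simp add: \<beta>_def log_def field_simps)
  ultimately have "1 * ln 2 < (2 * \<beta>) * ln (2::real)" by simp
  then have \<beta>: "2 * \<beta> > 1" by (subst (asm) mult_less_cancel_right_pos) auto
  then have m: "0 < m" "m < 1" by (auto simp: m_def)
  have m_eq: "m * (ln 3 - ln 2 / 2) = ln 2"
    using \<beta> by (simp add: \<beta>_eq[symmetric] m_def)
  fix A B C D :: real
  assume nn: "0 \<le> A" "0 \<le> B" "0 \<le> C" "0 \<le> D" and sums: "A + B = 1" "C + D = 1"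
  define s t c d where "s = A powr (1 / 4)" and "t = B powr (1 / 4)"
    and "c = C powr \<beta>" and "d = D powr \<beta>"
  have pow: "(x powr (1 / 4)) ^ 4 = x" "(x powr (1 / 4)) ^ 3 = x powr (3 / 4)" if "0 \<le> x" for x :: real
    using powr_power[of x "1 / 4" 4] powr_power[of x "1 / 4" 3] that by (cases "x = 0"; simp)+
  have mroot: "(x powr \<beta>)\<^sup>2 powr m = x" if "0 \<le> x" for x :: real
    using that \<beta> by (simp add: power2_eq_square powr_add[symmetric] powr_powr m_def)
  define R where "R = (c ^ 4 + c\<^sup>2 * d\<^sup>2 + d ^ 4) / sqrt (c ^ 4 + d ^ 4)"
  have pos: "c > 0 \<or> d > 0" using nn sums by (auto simp: c_def d_def)
  have "R powr m \<le> c\<^sup>2 powr m + d\<^sup>2 powr m"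
    using quadratic_ratio_powr_le[of "c\<^sup>2" "d\<^sup>2" m] m m_eq pos by (auto simp: R_def simp flip: power_mult)
  also have "\<dots> = 1" using nn sums by (simp add: c_def d_def mroot)
  finally have "R \<le> 1" using m gr_one_powr[of R m] by linarith
  moreover have "((s ^ 3)\<^sup>2 + (t ^ 3)\<^sup>2) * (c\<^sup>2 + d\<^sup>2) + 2 * (s ^ 3 * t ^ 3) * (c * d) \<le> R"
    unfolding R_def using pos nn sums
    by (intro quadratic_form_le_of_quartic_sum) (auto simp: s_def t_def c_def d_def pow)
  ultimately have "((s ^ 3)\<^sup>2 + (t ^ 3)\<^sup>2) * (c\<^sup>2 + d\<^sup>2) + 2 * (s ^ 3 * t ^ 3) * (c * d) \<le> 1"
    by linarith
  moreover have "s ^ 3 = A powr (3 / 4)" "t ^ 3 = B powr (3 / 4)"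
    using nn by (simp_all add: s_def t_def pow)
  ultimately have "(A powr (3/4) * c)\<^sup>2 + (A powr (3/4) * d + B powr (3/4) * c)\<^sup>2 + (B powr (3/4) * d)\<^sup>2 \<le> 1"
    by (simp add: power2_eq_square algebra_simps)
  then show "(A powr (3/4) * C powr (log 2 3 / 2 - 1 / 4))\<^sup>2 +
       (A powr (3/4) * D powr (log 2 3 / 2 - 1 / 4) + B powr (3/4) * C powr (log 2 3 / 2 - 1 / 4))\<^sup>2 +
       (B powr (3/4) * D powr (log 2 3 / 2 - 1 / 4))\<^sup>2 \<le> 1"
    by (simp add: c_def d_def \<beta>_def)
qed

text \<open>
  Second-order perturbation of the case of equality \<open>A = B = C = D = 1/2\<close>.
\<close>
lemma two_point_imp_le:
  assumes T: "two_point \<alpha> \<beta>" and sum: "\<alpha> + \<beta> = log 2 6 / 2" and \<alpha>: "\<alpha> > 0"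
  shows "\<alpha> \<le> 3 / 4"
proof -
  define \<phi> where "\<phi> = (\<lambda>u::real. ((1 + u) powr \<alpha>)\<^sup>2 + ((1 + u) powr \<alpha> + (1 - u) powr \<alpha>)\<^sup>2 + ((1 - u) powr \<alpha>)\<^sup>2 - 6)"
  have half: "(2 powr \<alpha> * 2 powr \<beta>)\<^sup>2 = (6::real)"
    by (simp add: powr_add[symmetric] sum powr_power)
  have "\<phi> u \<le> 0" if u: "0 < u" "u < 1" for u
  proof -
    let ?k = "inverse (2 powr \<alpha> * 2 powr \<beta>)"
    have *: "((1 + u) / 2) powr \<alpha> * (1 / 2) powr \<beta> = ?k * (1 + u) powr \<alpha>"
            "((1 - u) / 2) powr \<alpha> * (1 / 2) powr \<beta> = ?k * (1 - u) powr \<alpha>"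
      using u by (simp_all add: powr_divide field_simps)
    have "?k\<^sup>2 * (\<phi> u + 6) \<le> 1"
      using two_pointD[OF T, of "(1 + u) / 2" "(1 - u) / 2" "1 / 2" "1 / 2"] u
      unfolding * \<phi>_def by (simp add: field_simps power2_eq_square)
    then show ?thesis unfolding power_inverse half by simp
  qed
  then have "eventually (\<lambda>u. \<phi> u / u\<^sup>2 \<le> 0) (at_right 0)"
    by (intro eventually_at_rightI[of 0 1]) (auto intro: divide_nonpos_nonneg)
  moreover have "((\<lambda>u. \<phi> u / u\<^sup>2) \<longlongrightarrow> 2 * (\<alpha> * \<alpha>) + 6 * (\<alpha> * (\<alpha> - 1))) (at_right 0)"
    unfolding \<phi>_def by real_asymp
  ultimately have "2 * (\<alpha> * \<alpha>) + 6 * (\<alpha> * (\<alpha> - 1)) \<le> 0"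
    by (intro tendsto_upperbound[where f = "\<lambda>u. \<phi> u / u\<^sup>2"]) auto
  then have "2 * \<alpha> * (4 * \<alpha> - 3) \<le> 0" by (simp add: algebra_simps)
  then show ?thesis using \<alpha> by (simp add: mult_le_0_iff)
qed

lemma two_point_iff:
  assumes \<alpha>: "\<alpha> > 0" and \<beta>: "\<beta> > 0" and sum: "\<alpha> + \<beta> = log 2 6 / 2"
  shows "two_point \<alpha> \<beta> \<longleftrightarrow> \<alpha> \<le> 3 / 4 \<and> \<beta> \<le> 3 / 4"
proof
  assume "two_point \<alpha> \<beta>"
  then show "\<alpha> \<le> 3 / 4 \<and> \<beta> \<le> 3 / 4"
    using two_point_imp_le[of \<alpha> \<beta>] two_point_imp_le[OF two_point_commute, of \<alpha> \<beta>] assms by auto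
next
  assume le: "\<alpha> \<le> 3 / 4 \<and> \<beta> \<le> 3 / 4"
  define \<gamma> :: real where "\<gamma> = log 2 3 / 2 - 1 / 4"
  have "log 2 6 = 1 + log 2 (3 :: real)"
    using log_mult[of 2 3 2] by simp
  then have sum': "\<alpha> + \<beta> = 3 / 4 + \<gamma>" using sum by (simp add: \<gamma>_def)
  have "log 2 3 < log 2 (4 :: real)" by simp
  moreover have "log 2 (4 :: real) = 2" using log_pow_cancel[of 2 2] by simp
  ultimately have \<gamma>: "\<gamma> < 3 / 4" by (simp add: \<gamma>_def)
  \<comment> \<open>\<open>(\<alpha>, \<beta>)\<close> lies on the segment from \<open>(3/4, \<gamma>)\<close> to \<open>(\<gamma>, 3/4)\<close>.\<close>
  define t where "t = (3 / 4 - \<alpha>) / (3 / 4 - \<gamma>)"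
  have t: "0 \<le> t" "t \<le> 1" using le sum' \<gamma> by (auto simp: t_def field_simps)
  have "t * (3 / 4 - \<gamma>) = 3 / 4 - \<alpha>" using \<gamma> by (simp add: t_def)
  moreover have "(1 - t) * (3 / 4) + t * \<gamma> = 3 / 4 - t * (3 / 4 - \<gamma>)"
    "(1 - t) * \<gamma> + t * (3 / 4) = \<gamma> + t * (3 / 4 - \<gamma>)"
    by (simp_all add: field_simps)
  ultimately have "(1 - t) * (3 / 4) + t * \<gamma> = \<alpha>" "(1 - t) * \<gamma> + t * (3 / 4) = \<beta>"
    using sum' by linarith+
  then show "two_point \<alpha> \<beta>"
    using two_point_interpolate[OF two_point_endpoint two_point_commute[OF two_point_endpoint] t]
    by (simp add: \<gamma>_def)
qed

section \<open>Tensorisation over the coordinates\<close>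

lemma two_point_norm:
  assumes T: "two_point (1 / p) (1 / q)" and p: "p > 0" and q: "q > 0"
    and nn: "0 \<le> a" "0 \<le> b" "0 \<le> c" "0 \<le> d"
  shows "(a * c)\<^sup>2 + (a * d + b * c)\<^sup>2 + (b * d)\<^sup>2
      \<le> ((a powr p + b powr p) powr (1 / p) * (c powr q + d powr q) powr (1 / q))\<^sup>2"
proof -
  define X Y where "X = a powr p + b powr p" and "Y = c powr q + d powr q"
  show ?thesis
  proof (cases "(a = 0 \<and> b = 0) \<or> (c = 0 \<and> d = 0)")
    case True
    then show ?thesis by auto
  next
    case False
    have X: "X > 0" and Y: "Y > 0"
      using False nn by (auto simp: X_def Y_def add_pos_nonneg add_nonneg_pos)
    define x y where "x = X powr (1 / p)" and "y = Y powr (1 / q)"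
    have x: "x > 0" and y: "y > 0" using X Y by (auto simp: x_def y_def)
    have root: "(u powr r / Z) powr (1 / r) = u / Z powr (1 / r)" if "r > 0" "u \<ge> 0" "Z > 0" for u r Z :: real
      using that by (simp add: powr_divide powr_powr)
    have "(a / x * (c / y))\<^sup>2 + (a / x * (d / y) + b / x * (c / y))\<^sup>2 + (b / x * (d / y))\<^sup>2 \<le> 1"
      using two_pointD[OF T, of "a powr p / X" "b powr p / X" "c powr q / Y" "d powr q / Y"] nn p q X Y
      by (simp add: root x_def y_def add_divide_distrib[symmetric]) (simp add: X_def Y_def)
    then have "((a * c)\<^sup>2 + (a * d + b * c)\<^sup>2 + (b * d)\<^sup>2) / (x * y)\<^sup>2 \<le> 1"
      by (simp only: times_divide_times_eq add_divide_distrib[symmetric] power_divide)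
    then show ?thesis
      using x y unfolding X_def[symmetric] Y_def[symmetric] x_def[symmetric] y_def[symmetric]
      by (subst (asm) pos_divide_le_eq) auto
  qed
qed

text \<open>
  The lattice points whose coordinates in \<open>I\<close> lie in \<open>V\<close> and whose other coordinates vanish. Keeping the ambient
  lattice fixed and letting \<open>I\<close> grow allows induction on the dimension.
\<close>
definition cube :: "int set \<Rightarrow> 'n set \<Rightarrow> (int ^ 'n) set" where
  "cube V I = {x. \<forall>i. x $ i \<in> (if i \<in> I then V else {0})}"

lemma finite_cube:
  assumes "finite V" shows "finite (cube V I)"
proof -
  have "cube V I \<subseteq> vec_lambda ` (UNIV \<rightarrow>\<^sub>E (V \<union> {0}))"
  proof
    fix x assume "x \<in> cube V I"
    then have "vec_nth x \<in> UNIV \<rightarrow>\<^sub>E (V \<union> {0})" by (auto simp: cube_def split: if_splits)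
    then show "x \<in> vec_lambda ` (UNIV \<rightarrow>\<^sub>E (V \<union> {0}))" by (metis image_eqI vec_nth_inverse)
  qed
  then show ?thesis by (rule finite_subset) (intro finite_imageI finite_PiE, use assms in auto)
qed

lemma cube_nth_eq_0:
  assumes "x \<in> cube V I" "j \<notin> I" shows "x $ j = 0"
proof -
  have "x $ j \<in> (if j \<in> I then V else {0})" using assms(1) unfolding cube_def by blast
  then show ?thesis using assms(2) by simp
qed

lemma sum_cube_insert:
  assumes "j \<notin> I"
  shows "(\<Sum>x\<in>cube V (insert j I). h x) = (\<Sum>v\<in>V. \<Sum>x\<in>cube V I. h (x + axis j v))"
  unfolding sum.cartesian_product
proof (rule sum.reindex_bij_witness[where j = "\<lambda>x. (x $ j, x - axis j (x $ j))" and i = "\<lambda>(v, x). x + axis j v"])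
  fix x assume x: "x \<in> cube V (insert j I)"
  have "x $ j \<in> V" "\<And>i. i \<in> I \<Longrightarrow> x $ i \<in> V" "\<And>i. i \<noteq> j \<Longrightarrow> i \<notin> I \<Longrightarrow> x $ i = 0"
    using x by (auto simp: cube_def split: if_splits)
  then show "(x $ j, x - axis j (x $ j)) \<in> V \<times> cube V I"
    using assms by (auto simp: cube_def axis_def split: if_splits)
next
  fix b assume b: "b \<in> V \<times> cube V I"
  then have "snd b $ j = 0" using assms cube_nth_eq_0[of "snd b"] by auto
  then show "((case b of (v, x) \<Rightarrow> x + axis j v) $ j,
      (case b of (v, x) \<Rightarrow> x + axis j v) - axis j ((case b of (v, x) \<Rightarrow> x + axis j v) $ j)) = b"
    by (auto simp: split_beta prod_eq_iff)
  show "(case b of (v, x) \<Rightarrow> x + axis j v) \<in> cube V (insert j I)"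
    using b assms by (auto simp: cube_def axis_def split: if_splits)
qed auto

lemma sum_cube_empty: "(\<Sum>x\<in>cube V ({} :: 'n::finite set). h x) = h 0"
proof -
  have "cube V ({} :: 'n::finite set) = {0}" by (auto simp: cube_def vec_eq_iff)
  then show ?thesis by simp
qed

text \<open>
  The hypothesis on \<open>g\<close> concerns the coordinates in \<open>I\<close> only, so it passes to the translate of \<open>g\<close> by a unit
  vector in another direction, which the induction step needs. No hypothesis on \<open>f\<close> is needed because the inner
  sum ranges over the cube.
\<close>
lemma convolution_cube_le:
  fixes f g :: "int ^ 'n \<Rightarrow> real"
  assumes T: "two_point (1 / p) (1 / q)" and p: "p > 0" and q: "q > 0"
    and "finite I" and "\<And>z. (\<exists>i\<in>I. z $ i \<notin> {0, 1}) \<Longrightarrow> g z = 0"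
  shows "(\<Sum>x\<in>cube {0, 1, 2} I. (\<Sum>y\<in>cube {0, 1} I. f y * g (x - y))\<^sup>2)
    \<le> ((\<Sum>y\<in>cube {0, 1} I. \<bar>f y\<bar> powr p) powr (1 / p) *
       (\<Sum>y\<in>cube {0, 1} I. \<bar>g y\<bar> powr q) powr (1 / q))\<^sup>2"
  using assms(4,5)
proof (induction I arbitrary: f g rule: finite_induct)
  case empty
  show ?case using p q by (simp add: sum_cube_empty powr_powr power_mult_distrib)
next
  case (insert j I)
  define e :: "int ^ 'n" where "e = axis j 1"
  define K L where "K = cube {0, 1} I" and "L = cube {0, 1, 2} I"
  define f' g' where "f' = (\<lambda>y. f (y + e))" and "g' = (\<lambda>y. g (y + e))"
  define h where "h = (\<lambda>f g (x :: int ^ 'n). \<Sum>y\<in>K. f y * g (x - y) :: real)"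
  define N where "N = (\<lambda>r (f :: int ^ 'n \<Rightarrow> real). (\<Sum>y\<in>K. \<bar>f y\<bar> powr r) powr (1 / r))"
  have ax: "axis j 0 = (0 :: int ^ 'n)" "axis j 2 = e + e"
    by (auto simp: e_def axis_def vec_eq_iff)
  have splitK: "(\<Sum>x\<in>cube {0, 1} (insert j I). u x) = (\<Sum>x\<in>K. u x) + (\<Sum>x\<in>K. u (x + e))"
    for u :: "int ^ 'n \<Rightarrow> real"
    using insert.hyps by (simp add: sum_cube_insert K_def ax e_def[symmetric])
  have splitL: "(\<Sum>x\<in>cube {0, 1, 2} (insert j I). u x) =
      (\<Sum>x\<in>L. u x) + (\<Sum>x\<in>L. u (x + e)) + (\<Sum>x\<in>L. u (x + (e + e)))" for u :: "int ^ 'n \<Rightarrow> real"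
    using insert.hyps by (simp add: sum_cube_insert L_def ax e_def[symmetric])
  have g: "g z = 0" if "z $ i \<notin> {0, 1}" "i = j \<or> i \<in> I" for z i
    using that by (intro insert.prems) auto
  have g'0: "g' z = 0" if z: "\<exists>i\<in>I. z $ i \<notin> {0, 1}" for z
  proof -
    obtain i where i: "i \<in> I" "z $ i \<notin> {0, 1}" using z by blast
    then have "i \<noteq> j" using insert.hyps by auto
    then show ?thesis unfolding g'_def using i by (intro g[of _ i]) (auto simp: e_def axis_def)
  qed
  have g0: "g z = 0" if "\<exists>i\<in>I. z $ i \<notin> {0, 1}" for z
    using that by (intro insert.prems) auto
  have Kj: "y $ j = 0" if "y \<in> K \<or> y \<in> L" for y
    using that insert.hyps by (auto simp: K_def L_def intro: cube_nth_eq_0)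
  \<comment> \<open>The three layers \<open>x\<^sub>j = 0, 1, 2\<close> of the convolution; \<open>h\<close> is the convolution over \<open>I\<close>.\<close>
  have conv: "(\<Sum>y\<in>cube {0, 1} (insert j I). f y * g (x - y)) = h f g x"
    "(\<Sum>y\<in>cube {0, 1} (insert j I). f y * g (x + e - y)) = h f g' x + h f' g x"
    "(\<Sum>y\<in>cube {0, 1} (insert j I). f y * g (x + (e + e) - y)) = h f' g' x" if x: "x \<in> L" for x
  proof -
    have z: "g (x - (y + e)) = 0" "g (x + (e + e) - y) = 0" if "y \<in> K" for y
      using Kj[of x] Kj[of y] x that by (auto intro!: g[of _ j] simp: e_def)
    have s: "x + e - (y + e) = x - y" "x + (e + e) - (y + e) = x + e - y" "x - y + e = x + e - y" for y
      by simp_all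
    show "(\<Sum>y\<in>cube {0, 1} (insert j I). f y * g (x - y)) = h f g x"
      "(\<Sum>y\<in>cube {0, 1} (insert j I). f y * g (x + e - y)) = h f g' x + h f' g x"
      "(\<Sum>y\<in>cube {0, 1} (insert j I). f y * g (x + (e + e) - y)) = h f' g' x"
      unfolding splitK h_def f'_def g'_def s using z by simp_all
  qed
  have IH: "(\<Sum>x\<in>L. (h u v x)\<^sup>2) \<le> (N p u * N q v)\<^sup>2" if "v = g \<or> v = g'" for u v
    unfolding h_def N_def K_def L_def by (rule insert.IH) (use that g0 g'0 in blast)
  have N: "0 \<le> N r u" for r u by (simp add: N_def)
  have L2: "L2_set (h u v) L \<le> N p u * N q v" if "v = g \<or> v = g'" for u v
    unfolding L2_set_def using real_sqrt_le_mono[OF IH[OF that, of u]] N[of p u] N[of q v] by simp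
  have "(\<Sum>x\<in>L. (h f g' x + h f' g x)\<^sup>2) = (L2_set (\<lambda>x. h f g' x + h f' g x) L)\<^sup>2"
    by (simp add: L2_set_def sum_nonneg)
  also have "\<dots> \<le> (N p f * N q g' + N p f' * N q g)\<^sup>2"
    using L2_set_triangle_ineq[of "h f g'" "h f' g" L] L2[of g' f] L2[of g f']
    by (intro power_mono) auto
  finally have mid: "(\<Sum>x\<in>L. (h f g' x + h f' g x)\<^sup>2) \<le> (N p f * N q g' + N p f' * N q g)\<^sup>2" .
  have "(\<Sum>x\<in>cube {0, 1, 2} (insert j I). (\<Sum>y\<in>cube {0, 1} (insert j I). f y * g (x - y))\<^sup>2)
      = (\<Sum>x\<in>L. (h f g x)\<^sup>2) + (\<Sum>x\<in>L. (h f g' x + h f' g x)\<^sup>2) + (\<Sum>x\<in>L. (h f' g' x)\<^sup>2)"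
    unfolding splitL by (simp only: conv cong: sum.cong)
  also have "\<dots> \<le> (N p f * N q g)\<^sup>2 + (N p f * N q g' + N p f' * N q g)\<^sup>2 + (N p f' * N q g')\<^sup>2"
    using IH[of g f] IH[of g' f'] mid by simp
  also have "\<dots> \<le> ((N p f powr p + N p f' powr p) powr (1 / p) * (N q g powr q + N q g' powr q) powr (1 / q))\<^sup>2"
    by (rule two_point_norm[OF T p q]) (rule N)+
  also have "N p f powr p + N p f' powr p = (\<Sum>y\<in>cube {0, 1} (insert j I). \<bar>f y\<bar> powr p)"
    using p unfolding splitK by (simp add: N_def f'_def powr_powr sum_nonneg)
  also have "N q g powr q + N q g' powr q = (\<Sum>y\<in>cube {0, 1} (insert j I). \<bar>g y\<bar> powr q)"
    using q unfolding splitK by (simp add: N_def g'_def powr_powr sum_nonneg)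
  finally show ?case .
qed

section \<open>The convolution inequality and the two-point inequality\<close>

lemma lp_norm_finite_support:
  assumes "finite S" and "\<And>x. x \<notin> S \<Longrightarrow> f x = 0"
  shows "lp_norm (ereal r) f = (\<Sum>x\<in>S. \<bar>f x\<bar> powr r) powr (1 / r)"
proof -
  have "(\<Sum>\<^sub>\<infinity>x. \<bar>f x\<bar> powr r) = infsum (\<lambda>x. \<bar>f x\<bar> powr r) S"
    by (rule infsum_cong_neutral) (use assms in auto)
  then show ?thesis using assms by (simp add: lp_norm_def)
qed

lemma lp_norm_2_finite_support:
  assumes "finite S" and "\<And>x. x \<notin> S \<Longrightarrow> f x = 0"
  shows "lp_norm 2 f = sqrt (\<Sum>x\<in>S. (f x)\<^sup>2)"
  using lp_norm_finite_support[OF assms, where r = 2]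
  by (simp add: powr_half_sqrt sum_nonneg flip: numeral_eq_ereal)

lemma convolution_finite_support:
  assumes "finite S" and "\<And>x. x \<notin> S \<Longrightarrow> f x = 0"
  shows "convolution f g x = (\<Sum>y\<in>S. f y * g (x - y))"
proof -
  have "(\<Sum>\<^sub>\<infinity>y. f y * g (x - y)) = infsum (\<lambda>y. f y * g (x - y)) S"
    by (rule infsum_cong_neutral) (use assms in auto)
  then show ?thesis using assms by (simp add: convolution_def)
qed

lemma lp_norm_convolution_le:
  fixes f g :: "int ^ 'n \<Rightarrow> real"
  assumes T: "two_point (1 / p) (1 / q)" and p: "p > 0" and q: "q > 0"
    and f: "supported_in_cube f" and g: "supported_in_cube g"
  shows "lp_norm 2 (convolution f g) \<le> lp_norm (ereal p) f * lp_norm (ereal q) g"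
proof -
  define K L :: "(int ^ 'n) set" where "K = cube {0, 1} UNIV" and "L = cube {0, 1, 2} UNIV"
  have fin: "finite K" "finite L" by (auto simp: K_def L_def finite_cube)
  have f0: "f x = 0" and g0: "g x = 0" if "x \<notin> K" for x
    using f g that by (auto simp: supported_in_cube_def K_def cube_def)
  have conv: "convolution f g x = (\<Sum>y\<in>K. f y * g (x - y))" for x
    using fin(1) f0 by (rule convolution_finite_support)
  have "convolution f g x = 0" if "x \<notin> L" for x
  proof -
    have "x - y \<notin> K" if y: "y \<in> K" for y
    proof
      assume "x - y \<in> K"
      have "x $ i \<in> {0, 1, 2}" for i
      proof -
        have "y $ i \<in> {0, 1}" "(x - y) $ i \<in> {0, 1}"
          using y \<open>x - y \<in> K\<close> by (auto simp: K_def cube_def)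
        then show ?thesis by auto
      qed
      then show False using \<open>x \<notin> L\<close> by (auto simp: L_def cube_def)
    qed
    then show ?thesis using g0 by (simp add: conv)
  qed
  then have "lp_norm 2 (convolution f g) = sqrt (\<Sum>x\<in>L. (\<Sum>y\<in>K. f y * g (x - y))\<^sup>2)"
    using fin by (subst lp_norm_2_finite_support[of L]) (auto simp: conv)
  also have "(\<Sum>x\<in>L. (\<Sum>y\<in>K. f y * g (x - y))\<^sup>2)
      \<le> ((\<Sum>y\<in>K. \<bar>f y\<bar> powr p) powr (1 / p) * (\<Sum>y\<in>K. \<bar>g y\<bar> powr q) powr (1 / q))\<^sup>2"
    unfolding K_def L_def
    by (rule convolution_cube_le[OF T p q]) (use g0 in \<open>auto simp: K_def cube_def\<close>)
  also have "(\<Sum>y\<in>K. \<bar>f y\<bar> powr p) powr (1 / p) = lp_norm (ereal p) f"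
    using lp_norm_finite_support[OF fin(1) f0] by simp
  also have "(\<Sum>y\<in>K. \<bar>g y\<bar> powr q) powr (1 / q) = lp_norm (ereal q) g"
    using lp_norm_finite_support[OF fin(1) g0] by simp
  finally show ?thesis
    by (simp add: lp_norm_def)
qed

text \<open>
  Test functions supported on \<open>0\<close> and a unit vector \<open>e\<close>; their convolution is supported on \<open>0\<close>, \<open>e\<close> and \<open>2e\<close>.
\<close>
lemma two_point_if_convolution_le:
  assumes H: "\<And>f g :: int ^ 'n \<Rightarrow> real. supported_in_cube f \<Longrightarrow> supported_in_cube g \<Longrightarrow>
      lp_norm 2 (convolution f g) \<le> lp_norm (ereal p) f * lp_norm (ereal q) g"
    and p: "p > 0" and q: "q > 0"
  shows "two_point (1 / p) (1 / q)"
  unfolding two_point_def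
proof (intro allI impI)
  fix A B C D :: real
  assume nn: "0 \<le> A" "0 \<le> B" "0 \<le> C" "0 \<le> D" and sums: "A + B = 1" "C + D = 1"
  obtain j :: 'n where True by simp
  define e :: "int ^ 'n" where "e = axis j 1"
  have ej: "e $ j = 1" by (simp add: e_def)
  have ne: "e \<noteq> 0" "e + e \<noteq> 0" "e + e \<noteq> e" "- e \<noteq> 0" "- e \<noteq> e"
    using ej by (auto simp: vec_eq_iff intro!: exI[of _ j])
  define F where "F = (\<lambda>a b x. if x = 0 then a else if x = e then b else (0 :: real))"
  have F0: "F a b x = 0" if "x \<notin> {0, e}" for a b x using that by (auto simp: F_def)
  have F: "supported_in_cube (F a b)" for a b
    by (auto simp: supported_in_cube_def F_def e_def axis_def)
  have norm: "lp_norm (ereal r) (F (a powr (1 / r)) (b powr (1 / r))) = 1"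
    if "r > 0" "0 \<le> a" "0 \<le> b" "a + b = 1" for r a b
    using that ne ne(1)[symmetric]
    by (subst lp_norm_finite_support[where S = "{0, e}", OF _ F0]) (auto simp: F_def powr_powr)
  define a b c d where "a = A powr (1 / p)" and "b = B powr (1 / p)"
    and "c = C powr (1 / q)" and "d = D powr (1 / q)"
  have conv: "convolution (F a b) (F c d) x = a * F c d x + b * F c d (x - e)" for x
    using ne ne(1)[symmetric]
    by (subst convolution_finite_support[where S = "{0, e}", OF _ F0]) (auto simp: F_def)
  have "lp_norm 2 (convolution (F a b) (F c d))
      = sqrt (\<Sum>x\<in>{0, e, e + e}. (convolution (F a b) (F c d) x)\<^sup>2)"
    by (rule lp_norm_2_finite_support, simp, unfold conv) (auto simp: F_def diff_eq_eq)
  also have "(\<Sum>x\<in>{0, e, e + e}. (convolution (F a b) (F c d) x)\<^sup>2)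
      = (a * c)\<^sup>2 + (a * d + b * c)\<^sup>2 + (b * d)\<^sup>2"
    unfolding conv using ne ne[symmetric] by (simp add: F_def)
  finally have "sqrt ((a * c)\<^sup>2 + (a * d + b * c)\<^sup>2 + (b * d)\<^sup>2) \<le> 1"
    using H[OF F F, of a b c d] norm[OF p nn(1,2) sums(1)] norm[OF q nn(3,4) sums(2)]
    by (simp add: a_def b_def c_def d_def)
  then show "(A powr (1 / p) * C powr (1 / q))\<^sup>2 + (A powr (1 / p) * D powr (1 / q)
      + B powr (1 / p) * C powr (1 / q))\<^sup>2 + (B powr (1 / p) * D powr (1 / q))\<^sup>2 \<le> 1"
    by (simp add: a_def b_def c_def d_def)
qed

theorem theorem1p4:
  fixes p q :: ereal
  assumes "1 \<le> p" and "1 \<le> q"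
    and "1 / p + 1 / q = ereal (log 2 6 / 2)"
  shows "(\<forall>f g :: int ^ 'n \<Rightarrow> real. supported_in_cube f \<longrightarrow> supported_in_cube g \<longrightarrow>
            lp_norm 2 (convolution f g) \<le> lp_norm p f * lp_norm q g)
          \<longleftrightarrow> p \<in> {ereal (4 / 3) .. ereal (1 / (log 2 3 / 2 - 1 / 4))} \<and>
              q \<in> {ereal (4 / 3) .. ereal (1 / (log 2 3 / 2 - 1 / 4))}"
proof -
  have log6: "log 2 6 = 1 + log 2 (3 :: real)"
    using log_mult[of 2 3 2] by simp
  have log3: "log 2 (3 :: real) > 1"
    by simp
  \<comment> \<open>If one exponent is infinite, the other has reciprocal \<open>log\<^sub>2 6 / 2 > 1\<close>, so it is less than \<open>1\<close>.\<close>
  have fin: "x \<noteq> \<infinity>" if xy: "1 \<le> y" "1 / x + 1 / y = ereal (log 2 6 / 2)" for x y :: ereal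
  proof
    assume "x = \<infinity>"
    then have eq: "1 / y = ereal (log 2 6 / 2)" using xy by simp
    show False
    proof (cases y)
      case (real r)
      then have "r \<ge> 1" "1 / r = log 2 6 / 2" using xy(1) eq by (auto simp: one_ereal_def)
      moreover have "1 / r \<le> 1" using \<open>r \<ge> 1\<close> by simp
      ultimately show False using log3 log6 by linarith
    qed (use xy(1) eq log3 log6 in \<open>auto simp: one_ereal_def\<close>)
  qed
  have "p \<noteq> \<infinity>" using fin[of q p] assms by simp
  moreover have "q \<noteq> \<infinity>" using fin[of p q] assms by (simp add: add.commute)
  ultimately obtain p' q' where pq: "p = ereal p'" "q = ereal q'"
    using assms by (cases p; cases q) auto
  have p: "p' \<ge> 1" and q: "q' \<ge> 1" using assms pq by (auto simp: one_ereal_def)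
  have sum: "1 / p' + 1 / q' = log 2 6 / 2"
    using assms(3) p q unfolding pq by (simp add: one_ereal_def)
  define \<gamma> :: real where "\<gamma> = log 2 3 / 2 - 1 / 4"
  have \<gamma>: "\<gamma> > 0" using log3 unfolding \<gamma>_def by linarith
  have sum': "1 / p' + 1 / q' = 3 / 4 + \<gamma>" using sum log6 by (simp add: \<gamma>_def)
  have lower: "1 / r \<le> 3 / 4 \<longleftrightarrow> 4 / 3 \<le> r" and upper: "\<gamma> \<le> 1 / r \<longleftrightarrow> r \<le> 1 / \<gamma>" if "r \<ge> 1" for r
    using that \<gamma> by (auto simp: field_simps)
  have "(\<forall>f g :: int ^ 'n \<Rightarrow> real. supported_in_cube f \<longrightarrow> supported_in_cube g \<longrightarrow>
            lp_norm 2 (convolution f g) \<le> lp_norm p f * lp_norm q g) \<longleftrightarrow> two_point (1 / p') (1 / q')"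
    unfolding pq
  proof
    assume "\<forall>f g :: int ^ 'n \<Rightarrow> real. supported_in_cube f \<longrightarrow> supported_in_cube g \<longrightarrow>
        lp_norm 2 (convolution f g) \<le> lp_norm (ereal p') f * lp_norm (ereal q') g"
    then show "two_point (1 / p') (1 / q')"
      using p q by (intro two_point_if_convolution_le[where 'n = 'n]) (blast, linarith+)
  next
    assume "two_point (1 / p') (1 / q')"
    then show "\<forall>f g :: int ^ 'n \<Rightarrow> real. supported_in_cube f \<longrightarrow> supported_in_cube g \<longrightarrow>
        lp_norm 2 (convolution f g) \<le> lp_norm (ereal p') f * lp_norm (ereal q') g"
      using p q by (intro allI impI lp_norm_convolution_le) linarith+
  qed
  also have "\<dots> \<longleftrightarrow> 1 / p' \<le> 3 / 4 \<and> 1 / q' \<le> 3 / 4"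
    using p q sum by (intro two_point_iff) auto
  \<comment> \<open>As \<open>1/p' + 1/q' = 3/4 + \<gamma>\<close>, an upper bound for one reciprocal is a lower bound for the other.\<close>
  also have "\<dots> \<longleftrightarrow> (1 / p' \<le> 3 / 4 \<and> \<gamma> \<le> 1 / p') \<and> (1 / q' \<le> 3 / 4 \<and> \<gamma> \<le> 1 / q')"
    using sum' by auto
  also have "\<dots> \<longleftrightarrow> p \<in> {ereal (4 / 3) .. ereal (1 / \<gamma>)} \<and> q \<in> {ereal (4 / 3) .. ereal (1 / \<gamma>)}"
    unfolding lower[OF p] lower[OF q] upper[OF p] upper[OF q] pq by simp
  finally show ?thesis unfolding \<gamma>_def .
qed

end
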